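(* Let $\alpha>0$, $0<c_{\mathrm{in}}<C_{\mathrm{out}}<\infty$ and $C_L\ge1$. There exists $\delta_0=\delta_0(\alpha,c_{\mathrm{in}},C_{\mathrm{out}},C_L)>0$ such that for every $0<\delta<\delta_0$ and every bi-Lipschitz $\delta$-pocket decomposition $\mathcal P_\delta$ of $\mathbb C$ with distinguished centers $\zeta_Q$ and geometric constants $c_{\mathrm{in}},C_{\mathrm{out}},C_L$, the following hold. (i) For every $\eta\in\mathbb C$ there exists a complex sequence $b(\eta)=(b_Q(\eta))_{Q\in\mathcal P_\delta}$ such that $$\kappa_\eta=\sum_{Q\in\mathcal P_\delta}b_Q(\eta)\,\kappa_{\zeta_Q},$$ with convergence in $\mathcal F_\alpha^2$. (ii) Let $0<\beta<1$ and $\gamma>0$. Then the coefficients in (i) can be chosen so that $$|b_Q(\eta)|\le C_{\mathrm{env}}\,e^{-\gamma|\zeta_Q-\eta|^\beta},\qquad Q\in\mathcal P_\delta,\ \eta\in\mathbb C,$$ where the constant $C_{\mathrm{env}}$ depends only on $\alpha,\beta,\gamma,\delta,c_{\mathrm{in}},C_{\mathrm{out}}$ and $C_L$.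
   Context: $\mathcal F_\alpha^2$ is the Hilbert space of entire functions $f$ with $\frac\alpha\pi\int_{\mathbb C}|f(z)|^2e^{-\alpha|z|^2}dA(z)<\infty$ ($dA$ Lebesgue area measure), with inner product $\langle f,g\rangle_\alpha=\frac\alpha\pi\int_{\mathbb C}f\overline g\,e^{-\alpha|z|^2}dA$. Normalized Fock kernels: $\kappa_w(z):=e^{\alpha\overline wz-\frac\alpha2|w|^2}$. A $\delta$-pocket decomposition of $\mathbb C$ with constants $0<c_{\mathrm{in}}<C_{\mathrm{out}}<\infty$ is a countable family $\mathcal P_\delta$ of Borel sets $Q\subset\mathbb C$ with distinguished centers $\zeta_Q\in Q$ such that: the sets are pairwise disjoint up to Lebesgue null sets and cover $\mathbb C$ up to a null set; and $B(\zeta_Q,c_{\mathrm{in}}\delta)\subset Q\subset B(\zeta_Q,C_{\mathrm{out}}\delta)$ for every $Q\in\mathcal P_\delta$ ($B(z,R)$ the open Euclidean disc). It is bi-Lipschitz with constant $C_L\ge1$ if there is a bijection $\Phi_\delta:\mathcal P_\delta\to\mathbb Z^2$ with $$C_L^{-1}\delta\,|\Phi_\delta(Q)-\Phi_\delta(Q')|\le|\zeta_Q-\zeta_{Q'}|\le C_L\delta\,|\Phi_\delta(Q)-\Phi_\delta(Q')|,\qquad Q,Q'\in\mathcal P_\delta.$$ The numbers $c_{\mathrm{in}},C_{\mathrm{out}},C_L$ are called its geometric constants. *)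

theory Defs
  imports "HOL-Analysis.Analysis"
begin

definition fock_space :: "real \<Rightarrow> (complex \<Rightarrow> complex) set" where
  "fock_space \<alpha> = {f. f holomorphic_on UNIV \<and>
     integrable lborel (\<lambda>z. (cmod (f z))\<^sup>2 * exp (- \<alpha> * (cmod z)\<^sup>2))}"

definition fock_inner :: "real \<Rightarrow> (complex \<Rightarrow> complex) \<Rightarrow> (complex \<Rightarrow> complex) \<Rightarrow> complex" where
  "fock_inner \<alpha> f g = of_real (\<alpha> / pi) *
     (LINT z|lborel. f z * cnj (g z) * of_real (exp (- \<alpha> * (cmod z)\<^sup>2)))"

definition fock_norm :: "real \<Rightarrow> (complex \<Rightarrow> complex) \<Rightarrow> real" where
  "fock_norm \<alpha> f = sqrt (Re (fock_inner \<alpha> f f))"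

definition fock_kernel :: "real \<Rightarrow> complex \<Rightarrow> complex \<Rightarrow> complex" where
  "fock_kernel \<alpha> w z = exp (of_real \<alpha> * cnj w * z - of_real (\<alpha> / 2 * (cmod w)\<^sup>2))"

text \<open>Convergence of an unordered series in the Fock space, in the sense of \<^const>\<open>has_sum\<close>:
  the finite partial sums converge in norm along the net of finite subsets of the index set.
  Membership is required because \<^const>\<open>fock_norm\<close> is only meaningful on \<^const>\<open>fock_space\<close>.\<close>

definition fock_has_sum ::
  "real \<Rightarrow> ('i \<Rightarrow> complex \<Rightarrow> complex) \<Rightarrow> (complex \<Rightarrow> complex) \<Rightarrow> 'i set \<Rightarrow> bool" where
  "fock_has_sum \<alpha> f g A \<longleftrightarrow>
     (\<forall>i\<in>A. f i \<in> fock_space \<alpha>) \<and> g \<in> fock_space \<alpha> \<and>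
     ((\<lambda>F. fock_norm \<alpha> (\<lambda>z. (\<Sum>i\<in>F. f i z) - g z)) \<longlongrightarrow> 0) (finite_subsets_at_top A)"

definition pocket_decomposition ::
  "real \<Rightarrow> real \<Rightarrow> real \<Rightarrow> complex set set \<Rightarrow> (complex set \<Rightarrow> complex) \<Rightarrow> bool" where
  "pocket_decomposition \<delta> c_in C_out P \<zeta> \<longleftrightarrow>
     countable P \<and>
     (\<forall>Q\<in>P. Q \<in> sets borel \<and> \<zeta> Q \<in> Q) \<and>
     (\<forall>Q\<in>P. \<forall>Q'\<in>P. Q \<noteq> Q' \<longrightarrow> Q \<inter> Q' \<in> null_sets lborel) \<and>
     UNIV - \<Union>P \<in> null_sets lborel \<and>
     (\<forall>Q\<in>P. ball (\<zeta> Q) (c_in * \<delta>) \<subseteq> Q \<and> Q \<subseteq> ball (\<zeta> Q) (C_out * \<delta>))"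

definition lattice_dist :: "int \<times> int \<Rightarrow> int \<times> int \<Rightarrow> real" where
  "lattice_dist m n =
     sqrt ((real_of_int (fst m - fst n))\<^sup>2 + (real_of_int (snd m - snd n))\<^sup>2)"

definition bilipschitz_pocket_decomposition ::
  "real \<Rightarrow> real \<Rightarrow> real \<Rightarrow> real \<Rightarrow> complex set set \<Rightarrow> (complex set \<Rightarrow> complex) \<Rightarrow> bool" where
  "bilipschitz_pocket_decomposition \<delta> c_in C_out C_L P \<zeta> \<longleftrightarrow>
     pocket_decomposition \<delta> c_in C_out P \<zeta> \<and>
     (\<exists>\<Phi> :: complex set \<Rightarrow> int \<times> int. bij_betw \<Phi> P UNIV \<and>
        (\<forall>Q\<in>P. \<forall>Q'\<in>P.
           inverse C_L * \<delta> * lattice_dist (\<Phi> Q) (\<Phi> Q') \<le> cmod (\<zeta> Q - \<zeta> Q') \<and>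
           cmod (\<zeta> Q - \<zeta> Q') \<le> C_L * \<delta> * lattice_dist (\<Phi> Q) (\<Phi> Q')))"

end

theory Submission
  imports Defs "HOL-Complex_Analysis.Cauchy_Integral_Formula" "HOL-Probability.Sinc_Integral"
begin

text \<open>
  Let \<open>p\<close> be a centre close to \<open>w\<close>. The quotient \<open>\<kappa>\<^sub>v(z) / \<kappa>\<^sub>v(p)\<close> is a holomorphic function of the
  conjugate of \<open>v - p\<close>, so Cauchy's formula on the unit circle around \<open>p\<close> writes \<open>\<kappa>\<^sub>w\<close> as a
  multiple of \<open>\<kappa>\<^sub>p\<close> plus a superposition of the kernels \<open>\<kappa>\<^sub>v\<close> with \<open>v\<close> on that circle, of total
  mass \<open>O(\<bar>w - p\<bar>)\<close>. Treating each \<open>\<kappa>\<^sub>v\<close> in the same way and iterating gives a Neumann series: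
  the \<open>n\<close>-th round contributes at most \<open>(e\<^sup>-\<^sup>2/2)\<^sup>n\<close> if \<open>\<delta>\<close> is small, and it only involves centres
  at distance at most \<open>2n + 1\<close> from \<open>w\<close>. Hence the coefficients decay like \<open>exp (- \<bar>\<zeta>\<^sub>Q - w\<bar>)\<close>,
  faster than \<open>exp (- \<gamma> \<bar>\<zeta>\<^sub>Q - w\<bar>\<^sup>\<beta>)\<close> for every \<open>\<beta> < 1\<close>. Local finiteness and
  summability over the centres come from the bi-Lipschitz indexing by the lattice.
\<close>

section \<open>Fock kernels and series of kernels\<close>

lemma fock_kernel_nonzero [simp]: "fock_kernel \<alpha> w z \<noteq> 0"
  by (simp add: fock_kernel_def)

text \<open>Polarization: 2 Re (cnj w z) = |z|^2 + |w|^2 - |z - w|^2. Divided by exp (\<alpha> / 2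
  |z|^2), the modulus is a Gaussian around \<open>w\<close>; kernels are estimated in this form
  below.\<close>

lemma cmod_fock_kernel:
  "cmod (fock_kernel \<alpha> w z) = exp (\<alpha> / 2 * (cmod z)\<^sup>2 - \<alpha> / 2 * (cmod (z - w))\<^sup>2)"
  by (simp add: fock_kernel_def cmod_power2) (simp add: power2_eq_square algebra_simps add_divide_distrib diff_divide_distrib)

lemma continuous_on_fock_kernel [continuous_intros]:
  assumes "continuous_on A f" "continuous_on A g"
  shows "continuous_on A (\<lambda>x. fock_kernel \<alpha> (f x) (g x))"
  unfolding fock_kernel_def using assms by (intro continuous_intros)

lemma borel_measurable_fock_kernel [measurable (raw)]:
  assumes "f \<in> borel_measurable M" "g \<in> borel_measurable M"
  shows "(\<lambda>x. fock_kernel \<alpha> (f x) (g x)) \<in> borel_measurable M"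
  by (rule borel_measurable_continuous_Pair[OF assms])
     (intro continuous_intros)

lemma borel_measurable_cnj [measurable (raw)]:
  "f \<in> borel_measurable M \<Longrightarrow> (\<lambda>x. cnj (f x)) \<in> borel_measurable M"
  by (rule borel_measurable_continuous_on[OF continuous_on_cnj[OF continuous_on_id]])

section \<open>Integrable exponential majorants on the line and the plane\<close>

lemma integrable_exp_minus_half_abs: "integrable lborel (\<lambda>x::real. exp (- \<bar>x\<bar> / 2))"
proof (rule Bochner_Integration.integrable_bound)
  show "integrable lborel (\<lambda>x::real. 8 * inverse (1 + x\<^sup>2))"
    using integrable_inverse_1_plus_square by (simp add: set_integrable_def einterval_def)
  show "AE x::real in lborel. norm (exp (- \<bar>x\<bar> / 2)) \<le> norm (8 * inverse (1 + x\<^sup>2))"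
  proof (rule AE_I2)
    fix x :: real
    \<comment> \<open>The quadratic Taylor polynomial of exp at |x| / 2 contains x^2 / 8, which
      gives the integrable majorant 8 / (1 + x^2).\<close>
    have "(1 + x\<^sup>2) / 8 \<le> 1 + \<bar>x\<bar> / 2 + (\<bar>x\<bar> / 2)\<^sup>2 / 2"
      by (simp add: power_divide)
    also have "\<dots> \<le> exp (\<bar>x\<bar> / 2)"
      by (rule exp_lower_Taylor_quadratic) simp
    finally have le: "(1 + x\<^sup>2) / 8 \<le> exp (\<bar>x\<bar> / 2)" .
    have "norm (exp (- \<bar>x\<bar> / 2)) = inverse (exp (\<bar>x\<bar> / 2))"
      by (simp flip: exp_minus)
    also have "\<dots> \<le> inverse ((1 + x\<^sup>2) / 8)"
      by (rule le_imp_inverse_le[OF le]) (simp add: add_pos_nonneg)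
    also have "\<dots> = norm (8 * inverse (1 + x\<^sup>2))"
      by (simp add: field_simps)
    finally show "norm (exp (- \<bar>x\<bar> / 2)) \<le> norm (8 * inverse (1 + x\<^sup>2))" .
  qed
qed simp

text \<open>Since |z| \<ge> (|Re z| + |Im z|) / 2, the case \<open>w = 0\<close> lies below a
  product of one-dimensional integrable functions; translation invariance gives general
  \<open>w\<close>.\<close>

lemma integrable_exp_minus_cmod: "integrable lborel (\<lambda>z. exp (- cmod (z - w)))"
proof -
  have "(\<integral>\<^sup>+z. (\<Prod>b\<in>(Basis::complex set). ennreal (exp (- \<bar>z \<bullet> b\<bar> / 2))) \<partial>lborel)
      = (\<Prod>b\<in>(Basis::complex set). (\<integral>\<^sup>+x. ennreal (exp (- \<bar>x\<bar> / 2)) \<partial>lborel))"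
    by (rule nn_integral_lborel_prod) auto
  also have "\<dots> < \<infinity>"
    using integrable_exp_minus_half_abs
    by (auto simp: integrable_iff_bounded Basis_complex_def ennreal_mult_less_top)
  finally have fin: "(\<integral>\<^sup>+z. (\<Prod>b\<in>(Basis::complex set). ennreal (exp (- \<bar>z \<bullet> b\<bar> / 2))) \<partial>lborel) < \<infinity>" .
  have le: "ennreal (exp (- cmod z)) \<le> (\<Prod>b\<in>Basis. ennreal (exp (- \<bar>z \<bullet> b\<bar> / 2)))" for z
  proof -
    have "exp (- cmod z) \<le> exp (- \<bar>Re z\<bar> / 2 + - \<bar>Im z\<bar> / 2)"
      using abs_Re_le_cmod[of z] abs_Im_le_cmod[of z] by simp
    thus ?thesis
      unfolding exp_add by (simp add: Basis_complex_def flip: ennreal_mult)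
  qed
  have int0: "integrable lborel (\<lambda>z. exp (- cmod z))"
    using order.strict_trans1[OF nn_integral_mono fin, OF le] by (simp add: integrable_iff_bounded)
  have "integrable (distr lborel borel ((+) (- w))) (\<lambda>z. exp (- cmod z))"
    unfolding lborel_distr_plus by (rule int0)
  from integrable_distr[OF _ this] show ?thesis by simp
qed

text \<open>Complete the square. This trades Gaussian decay for exponential decay.\<close>

lemma linear_minus_square_le:
  fixes \<alpha> s c :: real
  assumes "\<alpha> > 0"
  shows "c * s - \<alpha> * s\<^sup>2 \<le> c\<^sup>2 / (4 * \<alpha>)"
proof -
  have "4 * \<alpha> * (c * s - \<alpha> * s\<^sup>2) = c\<^sup>2 - (2 * \<alpha> * s - c)\<^sup>2"
    by (simp add: power2_eq_square algebra_simps)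
  also have "\<dots> \<le> c\<^sup>2" by simp
  finally show ?thesis
    using assms by (simp add: pos_le_divide_eq mult.commute)
qed

lemma fock_kernel_in_fock_space:
  assumes "\<alpha> > 0"
  shows "(\<lambda>z. c * fock_kernel \<alpha> w z) \<in> fock_space \<alpha>"
  unfolding fock_space_def
proof (intro CollectI conjI)
  show "(\<lambda>z. c * fock_kernel \<alpha> w z) holomorphic_on UNIV"
    unfolding fock_kernel_def by (intro holomorphic_intros)
  show "integrable lborel (\<lambda>z. (cmod (c * fock_kernel \<alpha> w z))\<^sup>2 * exp (- \<alpha> * (cmod z)\<^sup>2))"
  proof (rule Bochner_Integration.integrable_bound[OF integrable_mult_right[OF integrable_exp_minus_cmod]])
    show "AE z in lborel. norm ((cmod (c * fock_kernel \<alpha> w z))\<^sup>2 * exp (- \<alpha> * (cmod z)\<^sup>2))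
        \<le> norm ((cmod c)\<^sup>2 * exp (1 / (4 * \<alpha>)) * exp (- cmod (z - w)))"
    proof (rule AE_I2)
      fix z
      have "(cmod (c * fock_kernel \<alpha> w z))\<^sup>2 * exp (- \<alpha> * (cmod z)\<^sup>2)
          = (cmod c)\<^sup>2 * exp (- \<alpha> * (cmod (z - w))\<^sup>2)"
        by (simp add: norm_mult power_mult_distrib cmod_fock_kernel mult.assoc algebra_simps
            flip: exp_double exp_add)
      also have "exp (- \<alpha> * (cmod (z - w))\<^sup>2) \<le> exp (1 / (4 * \<alpha>) + - cmod (z - w))"
        using linear_minus_square_le[OF assms, of 1 "cmod (z - w)"] by simp
      finally show "norm ((cmod (c * fock_kernel \<alpha> w z))\<^sup>2 * exp (- \<alpha> * (cmod z)\<^sup>2))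
          \<le> norm ((cmod c)\<^sup>2 * exp (1 / (4 * \<alpha>)) * exp (- cmod (z - w)))"
        by (simp add: mult_left_mono mult.assoc flip: exp_add)
    qed
  qed measurable
qed

section \<open>From pointwise sums of kernels to convergence in norm\<close>

lemma has_sum_cofinite:
  fixes f :: "'a \<Rightarrow> 'b::{topological_ab_group_add, t2_space}"
  assumes "(f has_sum s) A" "finite F" "F \<subseteq> A"
  shows "(f has_sum (s - sum f F)) (A - F)"
proof -
  have "f summable_on (A - F)"
    using assms by (intro summable_on_cofin_subset) (auto simp: summable_on_def)
  then obtain t where t: "(f has_sum t) (A - F)"
    by (auto simp: summable_on_def)
  have "(f has_sum (t + sum f F)) ((A - F) \<union> F)"
    using assms(2) by (intro has_sum_Un_disjoint t has_sum_finite) auto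
  moreover have "(A - F) \<union> F = A" using assms(3) by auto
  ultimately have "t + sum f F = s"
    using assms(1) has_sum_unique by metis
  hence "t = s - sum f F" by (simp add: eq_diff_eq)
  thus ?thesis using t by simp
qed

text \<open>Squaring the pointwise bound cancels the weight and leaves B^2 exp (- |z - w|), which is
  integrable.\<close>

lemma fock_norm_le:
  assumes \<alpha>: "\<alpha> > 0" and B: "\<And>z. cmod (g z) \<le> B * exp (\<alpha> / 2 * (cmod z)\<^sup>2) * exp (- cmod (z - w) / 2)"
  shows "fock_norm \<alpha> g \<le> \<bar>B\<bar> * sqrt (\<alpha> / pi * (LINT z|lborel. exp (- cmod (z - w))))"
proof -
  define J where "J = (LINT z|lborel. exp (- cmod (z - w)))"
  have "0 \<le> J" unfolding J_def by (rule integral_nonneg_AE) simp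
  have "cmod (LINT z|lborel. g z * cnj (g z) * of_real (exp (- \<alpha> * (cmod z)\<^sup>2))) \<le> B\<^sup>2 * J"
  proof (cases "integrable lborel (\<lambda>z. g z * cnj (g z) * of_real (exp (- \<alpha> * (cmod z)\<^sup>2)))")
    case True
    have "cmod (LINT z|lborel. g z * cnj (g z) * of_real (exp (- \<alpha> * (cmod z)\<^sup>2)))
        \<le> (LINT z|lborel. B\<^sup>2 * exp (- cmod (z - w)))"
    proof (rule Bochner_Integration.integral_norm_bound_integral[OF True
          integrable_mult_right[OF integrable_exp_minus_cmod]])
      fix z
      have "(cmod (g z))\<^sup>2 \<le> (B * exp (\<alpha> / 2 * (cmod z)\<^sup>2) * exp (- cmod (z - w) / 2))\<^sup>2"
        by (intro power_mono B) auto
      also have "\<dots> = B\<^sup>2 * exp (- cmod (z - w)) * exp (\<alpha> * (cmod z)\<^sup>2)"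
        by (simp add: power_mult_distrib flip: exp_double)
      finally have "(cmod (g z))\<^sup>2 * exp (- \<alpha> * (cmod z)\<^sup>2)
          \<le> (B\<^sup>2 * exp (- cmod (z - w)) * exp (\<alpha> * (cmod z)\<^sup>2)) * exp (- \<alpha> * (cmod z)\<^sup>2)"
        by (rule mult_right_mono) simp
      also have "\<dots> = B\<^sup>2 * exp (- cmod (z - w))"
        by (simp add: mult.assoc flip: exp_add)
      finally show "cmod (g z * cnj (g z) * of_real (exp (- \<alpha> * (cmod z)\<^sup>2))) \<le> B\<^sup>2 * exp (- cmod (z - w))"
        by (simp add: norm_mult power2_eq_square)
    qed
    thus ?thesis by (simp add: J_def)
  \<comment> \<open>A non-integrable integrand has Bochner integral 0, so the bound is trivial in
    this case.\<close>
  qed (use \<open>0 \<le> J\<close> in \<open>simp add: not_integrable_integral_eq\<close>)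
  hence "cmod (fock_inner \<alpha> g g) \<le> \<alpha> / pi * (B\<^sup>2 * J)"
    unfolding fock_inner_def norm_mult using \<alpha> by (intro mult_mono) (auto simp: norm_divide)
  hence "Re (fock_inner \<alpha> g g) \<le> B\<^sup>2 * (\<alpha> / pi * J)"
    using complex_Re_le_cmod[of "fock_inner \<alpha> g g"] by (simp add: mult_ac)
  hence "sqrt (Re (fock_inner \<alpha> g g)) \<le> sqrt (B\<^sup>2 * (\<alpha> / pi * J))"
    by (rule real_sqrt_le_mono)
  thus ?thesis
    by (simp only: fock_norm_def J_def real_sqrt_mult real_sqrt_abs)
qed

text \<open>The error after finitely many terms is pointwise a tail of the series. It is bounded by
  a fixed profile of finite norm times the tail of a convergent scalar series, so
  \<open>fock_norm_le\<close> makes it tend to 0 in norm.\<close>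

lemma fock_has_sum_kernels:
  assumes \<alpha>: "\<alpha> > 0"
    and hs: "\<And>z. ((\<lambda>i. b i * fock_kernel \<alpha> (\<zeta> i) z) has_sum fock_kernel \<alpha> w z) A"
    and b: "\<And>i. i \<in> A \<Longrightarrow> cmod (b i) \<le> C * exp (- cmod (\<zeta> i - w))"
    and summ: "(\<lambda>i. exp (- cmod (\<zeta> i - w) / 2)) summable_on A"
  shows "fock_has_sum \<alpha> (\<lambda>i z. b i * fock_kernel \<alpha> (\<zeta> i) z) (fock_kernel \<alpha> w) A"
  unfolding fock_has_sum_def
proof (intro conjI ballI)
  show "fock_kernel \<alpha> w \<in> fock_space \<alpha>"
    using fock_kernel_in_fock_space[OF \<alpha>, of 1 w] by simp
  show "(\<lambda>z. b i * fock_kernel \<alpha> (\<zeta> i) z) \<in> fock_space \<alpha>" for i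
    by (rule fock_kernel_in_fock_space[OF \<alpha>])
  \<comment> \<open>The exponent is the maximum of s / 2 - \<alpha> s^2 / 2 over real s.\<close>
  define D where "D = exp (1 / (8 * \<alpha>))"
  define J where "J = sqrt (\<alpha> / pi * (LINT z|lborel. exp (- cmod (z - w))))"
  define e where "e i = exp (- cmod (\<zeta> i - w) / 2)" for i
  obtain T where T: "(e has_sum T) A"
    using summ by (auto simp: summable_on_def e_def[abs_def])
  \<comment> \<open>One half of the exponent in the decay of \<open>b i\<close> is spent on moving the Gaussian from \<open>\<zeta> i\<close>
    to \<open>w\<close>, uniformly in \<open>i\<close>; the other half makes the tails of the series small.\<close>
  have bound: "cmod (b i * fock_kernel \<alpha> (\<zeta> i) z)
      \<le> (C * D * exp (\<alpha> / 2 * (cmod z)\<^sup>2) * exp (- cmod (z - w) / 2)) * e i" if "i \<in> A" for i z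
  proof -
    \<comment> \<open>The mere existence of an index in \<open>A\<close> fixes the sign of
      \<open>C\<close>.\<close>
    have C: "0 \<le> C"
    proof -
      have "0 \<le> C * exp (- cmod (\<zeta> i - w))"
        using b[OF that] norm_ge_zero order_trans by blast
      thus ?thesis by (simp add: zero_le_mult_iff)
    qed
    have "cmod (b i * fock_kernel \<alpha> (\<zeta> i) z)
        \<le> C * exp (- cmod (\<zeta> i - w)) * exp (\<alpha> / 2 * (cmod z)\<^sup>2 - \<alpha> / 2 * (cmod (z - \<zeta> i))\<^sup>2)"
      unfolding norm_mult cmod_fock_kernel using b[OF that] by (intro mult_right_mono) auto
    also have "\<dots> = C * exp (- cmod (\<zeta> i - w) + (\<alpha> / 2 * (cmod z)\<^sup>2 - \<alpha> / 2 * (cmod (z - \<zeta> i))\<^sup>2))"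
      by (simp only: mult.assoc exp_add)
    also have "\<dots> \<le> C * exp (1 / (8 * \<alpha>) + \<alpha> / 2 * (cmod z)\<^sup>2 + - cmod (z - w) / 2 + - cmod (\<zeta> i - w) / 2)"
    proof -
      have "cmod (z - w) \<le> cmod (z - \<zeta> i) + cmod (\<zeta> i - w)"
        using norm_triangle_ineq[of "z - \<zeta> i" "\<zeta> i - w"] by simp
      moreover have "1 / 2 * cmod (z - \<zeta> i) - \<alpha> / 2 * (cmod (z - \<zeta> i))\<^sup>2 \<le> 1 / (8 * \<alpha>)"
        using linear_minus_square_le[of "\<alpha> / 2" "1 / 2" "cmod (z - \<zeta> i)"] \<alpha> by (simp add: power_divide)
      ultimately show ?thesis
        using C by (intro mult_left_mono) auto
    qed
    also have "\<dots> = (C * D * exp (\<alpha> / 2 * (cmod z)\<^sup>2) * exp (- cmod (z - w) / 2)) * e i"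
      by (simp only: D_def e_def exp_add mult.assoc)
    finally show ?thesis .
  qed
  have norm_le: "fock_norm \<alpha> (\<lambda>z. (\<Sum>i\<in>F. b i * fock_kernel \<alpha> (\<zeta> i) z) - fock_kernel \<alpha> w z)
      \<le> \<bar>C * D * (T - sum e F)\<bar> * J" if F: "finite F" "F \<subseteq> A" for F
    unfolding J_def
  proof (rule fock_norm_le[OF \<alpha>])
    fix z
    have "cmod (fock_kernel \<alpha> w z - (\<Sum>i\<in>F. b i * fock_kernel \<alpha> (\<zeta> i) z))
        \<le> (C * D * exp (\<alpha> / 2 * (cmod z)\<^sup>2) * exp (- cmod (z - w) / 2)) * (T - sum e F)"
      by (rule norm_infsum_le[OF has_sum_cofinite[OF hs F] has_sum_cmult_right[OF has_sum_cofinite[OF T F]]])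
         (use bound in auto)
    thus "cmod ((\<Sum>i\<in>F. b i * fock_kernel \<alpha> (\<zeta> i) z) - fock_kernel \<alpha> w z)
        \<le> C * D * (T - sum e F) * exp (\<alpha> / 2 * (cmod z)\<^sup>2) * exp (- cmod (z - w) / 2)"
      by (simp only: norm_minus_commute mult_ac)
  qed
  have "(sum e \<longlongrightarrow> T) (finite_subsets_at_top A)"
    using T by (simp add: has_sum_def)
  hence "((\<lambda>F. \<bar>C * D * (T - sum e F)\<bar> * J) \<longlongrightarrow> \<bar>C * D * (T - T)\<bar> * J) (finite_subsets_at_top A)"
    by (intro tendsto_intros)
  hence lim: "((\<lambda>F. \<bar>C * D * (T - sum e F)\<bar> * J) \<longlongrightarrow> 0) (finite_subsets_at_top A)"
    by simp
  show "((\<lambda>F. fock_norm \<alpha> (\<lambda>z. (\<Sum>i\<in>F. b i * fock_kernel \<alpha> (\<zeta> i) z) - fock_kernel \<alpha> w z)) \<longlongrightarrow> 0)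
      (finite_subsets_at_top A)"
  proof (rule tendsto_sandwich[OF _ _ tendsto_const lim])
    \<comment> \<open>The square root of a negative real is negative in HOL, so this needs the inner
      product of a function with itself to be real and nonnegative.\<close>
    show "\<forall>\<^sub>F F in finite_subsets_at_top A. 0 \<le>
        fock_norm \<alpha> (\<lambda>z. (\<Sum>i\<in>F. b i * fock_kernel \<alpha> (\<zeta> i) z) - fock_kernel \<alpha> w z)"
    proof (rule always_eventually, rule allI)
      fix F
      let ?g = "\<lambda>z. (\<Sum>i\<in>F. b i * fock_kernel \<alpha> (\<zeta> i) z) - fock_kernel \<alpha> w z"
      have "fock_inner \<alpha> ?g ?g = of_real (\<alpha> / pi *
          (LINT z|lborel. (cmod (?g z))\<^sup>2 * exp (- \<alpha> * (cmod z)\<^sup>2)))"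
        unfolding fock_inner_def complex_norm_square[symmetric] of_real_mult integral_complex_of_real[symmetric] ..
      moreover have "0 \<le> (LINT z|lborel. (cmod (?g z))\<^sup>2 * exp (- \<alpha> * (cmod z)\<^sup>2))"
        by (rule integral_nonneg_AE) simp
      ultimately show "0 \<le> fock_norm \<alpha> ?g"
        using \<alpha> by (simp add: fock_norm_def)
    qed
    show "\<forall>\<^sub>F F in finite_subsets_at_top A.
        fock_norm \<alpha> (\<lambda>z. (\<Sum>i\<in>F. b i * fock_kernel \<alpha> (\<zeta> i) z) - fock_kernel \<alpha> w z)
        \<le> \<bar>C * D * (T - sum e F)\<bar> * J"
      by (rule eventually_finite_subsets_at_top_weakI) (use norm_le in blast)
  qed
qed

section \<open>Cauchy's formula for kernels\<close>

text \<open>Parameter space of the unit circle: \<open>t\<close> stands for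
  \<open>cis (2 * pi * t)\<close>, and integration is averaging over normalized arc length. As a
  probability measure it turns sup bounds directly into integral bounds.\<close>

definition circ :: "real measure" where
  "circ = restrict_space lborel {0..1}"

lemma space_circ [simp]: "space circ = {0..1}"
  by (simp add: circ_def space_restrict_space)

lemma prob_space_circ: "prob_space circ"
  by (rule prob_spaceI) (simp add: circ_def space_restrict_space emeasure_restrict_space)

interpretation circ: prob_space circ
  by (rule prob_space_circ)

lemma measurable_circ_cis [measurable]: "(\<lambda>t. cis (2 * pi * t)) \<in> borel_measurable circ"
proof -
  have "(\<lambda>t. cis (2 * pi * t)) \<in> borel_measurable borel"
    by (intro borel_measurable_continuous_onI continuous_intros)
  thus ?thesis
    unfolding circ_def by (intro measurable_restrict_space1) simp
qed

lemma circ_integral_continuous: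
  fixes f :: "real \<Rightarrow> complex"
  assumes "continuous_on {0..1} f"
  shows "integral\<^sup>L circ f = integral {0..1} f"
proof -
  have "set_integrable lborel {0..1} f"
    by (rule borel_integrable_atLeastAtMost'[OF assms])
  from set_borel_integral_eq_integral(2)[OF this] show ?thesis
    by (simp add: circ_def integral_restrict_space set_lebesgue_integral_def)
qed

text \<open>Subtract Cauchy's formula at 0 from the one at \<open>a\<close>. In normalized arc
  length the difference of the two Cauchy kernels is u / (u - a) - 1 = a / (u - a); the factor
  \<open>a\<close> makes the remainder small.\<close>

lemma cauchy_circ:
  assumes hol: "f holomorphic_on UNIV" and a: "cmod a < 1"
  shows "f a = f 0 + (LINT t|circ. a / (cis (2 * pi * t) - a) * f (cis (2 * pi * t)))"
proof -
  have C: "((\<lambda>u. f u / (u - b)) has_contour_integral (2 * of_real pi * \<i> * f b)) (circlepath 0 1)"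
    if "cmod b < 1" for b
    by (rule Cauchy_integral_circlepath)
       (use hol that in \<open>auto intro: holomorphic_on_imp_continuous_on holomorphic_on_subset\<close>)
  have "((\<lambda>u. f u / (u - a) - f u / (u - 0)) has_contour_integral
      (2 * of_real pi * \<i> * f a - 2 * of_real pi * \<i> * f 0)) (circlepath 0 1)"
    by (intro has_contour_integral_diff C) (use a in auto)
  hence "((\<lambda>t. (f (cis (2 * pi * t)) / (cis (2 * pi * t) - a) - f (cis (2 * pi * t)) / cis (2 * pi * t)) *
        (2 * of_real pi * \<i> * cis (2 * pi * t))) has_integral
      (2 * of_real pi * \<i> * f a - 2 * of_real pi * \<i> * f 0)) {0..1}"
    unfolding has_contour_integral vector_derivative_circlepath
    by (simp add: circlepath cis_conv_exp mult_ac)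
  hence "((\<lambda>t. inverse (2 * of_real pi * \<i>) * ((f (cis (2 * pi * t)) / (cis (2 * pi * t) - a) - f (cis (2 * pi * t)) / cis (2 * pi * t)) *
        (2 * of_real pi * \<i> * cis (2 * pi * t)))) has_integral
      inverse (2 * of_real pi * \<i>) * (2 * of_real pi * \<i> * f a - 2 * of_real pi * \<i> * f 0)) {0..1}"
    by (rule has_integral_mult_right)
  moreover have ne: "cis s \<noteq> a" for s
    using a by (metis norm_cis less_irrefl)
  have "inverse (2 * of_real pi * \<i>) * ((f (cis s) / (cis s - a) - f (cis s) / cis s) *
        (2 * of_real pi * \<i> * cis s)) = a / (cis s - a) * f (cis s)" for s
    using ne[of s] by (simp add: field_simps)
  moreover have "inverse (2 * of_real pi * \<i>) * (2 * of_real pi * \<i> * f a - 2 * of_real pi * \<i> * f 0) = f a - f 0"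
    by (simp add: field_simps)
  ultimately have "((\<lambda>t. a / (cis (2 * pi * t) - a) * f (cis (2 * pi * t))) has_integral (f a - f 0)) {0..1}"
    by simp
  hence "integral {0..1} (\<lambda>t. a / (cis (2 * pi * t) - a) * f (cis (2 * pi * t))) = f a - f 0"
    by (rule integral_unique)
  moreover have "continuous_on {0..1} (\<lambda>t. a / (cis (2 * pi * t) - a) * f (cis (2 * pi * t)))"
    using ne by (intro continuous_intros continuous_on_compose2[OF holomorphic_on_imp_continuous_on[OF hol]]) auto
  ultimately show ?thesis
    by (simp add: circ_integral_continuous)
qed

text \<open>Dividing a kernel by its value at \<open>p\<close> removes the factor with |v|^2, and
  what is left is entire in cnj (v - p). \<open>cauchy_circ\<close> applies to it at
  \<open>h\<close>; the value at 0 produces the kernel of \<open>p\<close>.\<close>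

lemma fock_kernel_circ:
  assumes "cmod (w - p) < 1"
  defines "h \<equiv> cnj (w - p)"
  shows "fock_kernel \<alpha> w z = fock_kernel \<alpha> w p / fock_kernel \<alpha> p p * fock_kernel \<alpha> p z +
    (LINT t|circ. fock_kernel \<alpha> w p / fock_kernel \<alpha> (p + cis (- (2 * pi * t))) p *
        (h / (cis (2 * pi * t) - h)) * fock_kernel \<alpha> (p + cis (- (2 * pi * t))) z)"
proof -
  define f where "f u = exp (of_real \<alpha> * (cnj p + u) * (z - p))" for u
  have quot: "fock_kernel \<alpha> v z / fock_kernel \<alpha> v p = f (cnj (v - p))" for v
    by (simp add: fock_kernel_def f_def flip: exp_diff) (simp add: algebra_simps)
  have "f h = f 0 + (LINT t|circ. h / (cis (2 * pi * t) - h) * f (cis (2 * pi * t)))"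
    by (rule cauchy_circ) (use assms in \<open>auto simp: f_def complex_mod_cnj simp del: complex_cnj_diff intro!: holomorphic_intros\<close>)
  hence "fock_kernel \<alpha> w p * f h = fock_kernel \<alpha> w p * f 0 +
      (LINT t|circ. fock_kernel \<alpha> w p * (h / (cis (2 * pi * t) - h) * f (cis (2 * pi * t))))"
    by (simp only: distrib_left integral_mult_right_zero)
  \<comment> \<open>cnj (v - p) = cis s means v = p + cis (- s): conjugation reverses the
    circle.\<close>
  moreover have "f (cis s) = fock_kernel \<alpha> (p + cis (- s)) z / fock_kernel \<alpha> (p + cis (- s)) p" for s
    unfolding quot by (simp add: cis_cnj)
  moreover have "f 0 = fock_kernel \<alpha> p z / fock_kernel \<alpha> p p"
    unfolding quot by simp
  moreover have "fock_kernel \<alpha> w p * f h = fock_kernel \<alpha> w z"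
    unfolding h_def quot[symmetric] by simp
  ultimately show ?thesis
    by (simp add: mult_ac)
qed

section \<open>Neumann series along a net of centres\<close>

text \<open>\<open>S\<close> picks a nearby centre for each point; its measurability permits
  integration over circles. \<open>\<rho>_small\<close> is calibrated so that one round costs a
  factor exp (- 2) / 2: exp (- 2) pays for moving by up to 2, and 1 / 2 for summing over
  rounds.\<close>

locale kernel_net =
  fixes \<alpha> \<rho> :: real and P :: "'i set" and \<zeta> :: "'i \<Rightarrow> complex" and S :: "complex \<Rightarrow> 'i"
  assumes \<alpha>_pos: "\<alpha> > 0"
    and \<rho>_small: "4 * exp (\<alpha> / 2 + 2) * \<rho> \<le> 1"
    and measurable_S [measurable]: "S \<in> borel \<rightarrow>\<^sub>M count_space P"
    and S_near: "cmod (w - \<zeta> (S w)) \<le> \<rho>"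
    and finite_near: "finite {Q\<in>P. cmod (\<zeta> Q - w) \<le> R}"
begin

lemma S_in [simp]: "S w \<in> P"
  using measurable_space[OF measurable_S, of w] by simp

lemma \<rho>_nonneg: "0 \<le> \<rho>"
  using S_near[of 0] norm_ge_zero[of "0 - \<zeta> (S 0)"] by linarith

text \<open>Keeps \<open>w\<close> at distance at least 1 / 2 from the unit circle around its
  centre, which bounds the Cauchy denominator from below.\<close>

lemma \<rho>_le_half: "\<rho> \<le> 1 / 2"
proof -
  have "exp 0 \<le> exp (\<alpha> / 2 + 2)"
    using \<alpha>_pos by (subst exp_le_cancel_iff) simp
  hence "4 * 1 * \<rho> \<le> 4 * exp (\<alpha> / 2 + 2) * \<rho>"
    using \<rho>_nonneg by (intro mult_right_mono) auto
  thus ?thesis using \<rho>_small by simp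
qed

section \<open>One round: replacing a kernel by its centre and a circle of kernels\<close>

definition centre :: "complex \<Rightarrow> complex" where
  "centre w = \<zeta> (S w)"

lemma measurable_centre [measurable]: "centre \<in> borel_measurable borel"
  unfolding centre_def[abs_def] by (rule measurable_compose[OF measurable_S]) simp

lemma centre_near: "cmod (w - centre w) \<le> \<rho>"
  unfolding centre_def by (rule S_near)

definition centre_coeff :: "complex \<Rightarrow> complex" where
  "centre_coeff w = fock_kernel \<alpha> w (centre w) / fock_kernel \<alpha> (centre w) (centre w)"

definition circ_point :: "complex \<Rightarrow> real \<Rightarrow> complex" where
  "circ_point w t = centre w + cis (- (2 * pi * t))"

definition circ_coeff :: "complex \<Rightarrow> real \<Rightarrow> complex" where
  "circ_coeff w t = fock_kernel \<alpha> w (centre w) / fock_kernel \<alpha> (circ_point w t) (centre w) *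
     (cnj (w - centre w) / (cis (2 * pi * t) - cnj (w - centre w)))"

text \<open>Acts on functions of the kernel parameter with \<open>z\<close> fixed, so the same
  operator transports both the kernels and their scalar coefficients.\<close>

definition circ_op :: "(complex \<Rightarrow> complex) \<Rightarrow> complex \<Rightarrow> complex" where
  "circ_op \<phi> w = (LINT t|circ. circ_coeff w t * \<phi> (circ_point w t))"

lemma measurable_centre_coeff [measurable]: "centre_coeff \<in> borel_measurable borel"
  unfolding centre_coeff_def[abs_def] by measurable

text \<open>Joint measurability in \<open>w\<close> and \<open>t\<close> makes the integral over
  \<open>t\<close> measurable in \<open>w\<close>, so \<open>circ_op\<close> can be
  iterated.\<close>

lemma measurable_circ_point [measurable]:
  "(\<lambda>(w, t). circ_point w t) \<in> borel_measurable (borel \<Otimes>\<^sub>M circ)"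
proof -
  have "(\<lambda>(w, t). centre w + cnj (cis (2 * pi * t))) \<in> borel_measurable (borel \<Otimes>\<^sub>M circ)"
    by measurable
  thus ?thesis by (simp add: circ_point_def cis_cnj)
qed

lemma measurable_circ_coeff [measurable]:
  "(\<lambda>(w, t). circ_coeff w t) \<in> borel_measurable (borel \<Otimes>\<^sub>M circ)"
  unfolding circ_coeff_def[abs_def] by measurable

lemma measurable_circ_op [measurable (raw)]:
  assumes [measurable]: "\<phi> \<in> borel_measurable borel"
  shows "circ_op \<phi> \<in> borel_measurable borel"
  unfolding circ_op_def[abs_def] by measurable

lemma cmod_centre_coeff: "cmod (centre_coeff w) \<le> 1"
  using \<alpha>_pos by (simp add: centre_coeff_def norm_divide cmod_fock_kernel flip: exp_diff)

lemma dist_circ_point: "cmod (circ_point w t - w) \<le> 2"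
proof -
  have "circ_point w t - w = cis (- (2 * pi * t)) - (w - centre w)"
    by (simp add: circ_point_def)
  also have "cmod \<dots> \<le> 1 + cmod (w - centre w)"
    by (metis norm_triangle_ineq4 norm_cis)
  finally show ?thesis
    using centre_near[of w] \<rho>_le_half by linarith
qed

text \<open>Circle points lie at distance 1 from the centre, so the kernel quotient is at most exp
  (\<alpha> / 2); the Cauchy factor is at most 2 \<rho>. \<open>\<rho>_small\<close> absorbs the
  product.\<close>

lemma cmod_circ_coeff: "cmod (circ_coeff w t) \<le> exp (- 2) / 2"
proof -
  define h where "h = cnj (w - centre w)"
  have h: "cmod h \<le> \<rho>"
    using centre_near[of w] by (simp only: h_def complex_mod_cnj)
  have "cmod (cis (2 * pi * t)) - cmod h \<le> cmod (cis (2 * pi * t) - h)"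
    by (rule norm_triangle_ineq2)
  hence "1 / 2 \<le> cmod (cis (2 * pi * t) - h)"
    using h \<rho>_le_half by simp
  hence 1: "cmod (h / (cis (2 * pi * t) - h)) \<le> \<rho> / (1 / 2)"
    unfolding norm_divide using h \<rho>_nonneg by (intro frac_le) auto
  have "cmod (fock_kernel \<alpha> w (centre w) / fock_kernel \<alpha> (circ_point w t) (centre w))
      = exp (\<alpha> / 2 - \<alpha> / 2 * (cmod (centre w - w))\<^sup>2)"
    by (simp add: norm_divide cmod_fock_kernel circ_point_def flip: exp_diff)
  also have "\<dots> \<le> exp (\<alpha> / 2)"
    using \<alpha>_pos by simp
  finally have "cmod (circ_coeff w t) \<le> exp (\<alpha> / 2) * (\<rho> / (1 / 2))"
    unfolding circ_coeff_def norm_mult h_def[symmetric] using 1 by (intro mult_mono) auto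
  also have "\<dots> = (4 * exp (\<alpha> / 2 + 2) * \<rho>) * (exp (- 2) / 2)"
    by (simp add: exp_add exp_minus)
  also have "\<dots> \<le> 1 * (exp (- 2) / 2)"
    by (rule mult_right_mono[OF \<rho>_small]) simp
  finally show ?thesis by simp
qed

lemma integrable_circ_op:
  assumes [measurable]: "\<phi> \<in> borel_measurable borel" and B: "\<And>w. cmod (\<phi> w) \<le> B"
  shows "integrable circ (\<lambda>t. circ_coeff w t * \<phi> (circ_point w t))"
proof (rule circ.integrable_const_bound)
  show "AE t in circ. cmod (circ_coeff w t * \<phi> (circ_point w t)) \<le> exp (- 2) / 2 * B"
    unfolding norm_mult by (intro AE_I2 mult_mono cmod_circ_coeff B) auto
  show "(\<lambda>t. circ_coeff w t * \<phi> (circ_point w t)) \<in> borel_measurable circ"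
    by measurable
qed

lemma cmod_circ_op:
  assumes [measurable]: "\<phi> \<in> borel_measurable borel" and B: "\<And>w. cmod (\<phi> w) \<le> B"
  shows "cmod (circ_op \<phi> w) \<le> exp (- 2) / 2 * B"
proof -
  have "cmod (circ_op \<phi> w) \<le> (LINT t|circ. exp (- 2) / 2 * B)"
    unfolding circ_op_def
  proof (rule Bochner_Integration.integral_norm_bound_integral[OF integrable_circ_op[OF assms]])
    show "cmod (circ_coeff w t * \<phi> (circ_point w t)) \<le> exp (- 2) / 2 * B" for t
      unfolding norm_mult by (intro mult_mono cmod_circ_coeff B) auto
  qed simp
  thus ?thesis by (simp add: circ.prob_space[simplified])
qed

lemma measurable_funpow_circ_op [measurable (raw)]:
  "\<phi> \<in> borel_measurable borel \<Longrightarrow> (circ_op ^^ n) \<phi> \<in> borel_measurable borel"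
  by (induction n) auto

lemma cmod_funpow_circ_op:
  assumes "\<phi> \<in> borel_measurable borel" and B: "\<And>w. cmod (\<phi> w) \<le> B"
  shows "cmod ((circ_op ^^ n) \<phi> w) \<le> (exp (- 2) / 2) ^ n * B"
proof (induction n arbitrary: w)
  case (Suc n)
  have "cmod (circ_op ((circ_op ^^ n) \<phi>) w) \<le> exp (- 2) / 2 * ((exp (- 2) / 2) ^ n * B)"
    using Suc assms(1) by (intro cmod_circ_op) auto
  thus ?case by simp
qed (use B in simp)

text \<open>The fixed-point equation behind the Neumann series: the kernel, as a function of its
  parameter, is an explicit term plus its own image under \<open>circ_op\<close>.\<close>

lemma fock_kernel_step:
  "fock_kernel \<alpha> w z =
     centre_coeff w * fock_kernel \<alpha> (centre w) z + circ_op (\<lambda>v. fock_kernel \<alpha> v z) w"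
proof -
  have "cmod (w - centre w) < 1"
    using centre_near[of w] \<rho>_le_half by linarith
  from fock_kernel_circ[OF this, of \<alpha> z] show ?thesis
    by (simp add: centre_coeff_def circ_op_def circ_coeff_def circ_point_def)
qed

text \<open>The weight that round \<open>n\<close> puts on the kernel of centre \<open>Q\<close>.
  The starting function isolates the points assigned to \<open>Q\<close>, which splits the explicit
  term of \<open>fock_kernel_step\<close> by centre.\<close>

definition coeff_term :: "nat \<Rightarrow> 'i \<Rightarrow> complex \<Rightarrow> complex" where
  "coeff_term n Q = (circ_op ^^ n) (\<lambda>w. if S w = Q then centre_coeff w else 0)"

lemma measurable_coeff_term_0: "(\<lambda>w. if S w = Q then centre_coeff w else 0) \<in> borel_measurable borel"
proof -
  have [measurable]: "(\<lambda>w. S w = Q) \<in> borel \<rightarrow>\<^sub>M count_space UNIV"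
    by (rule measurable_compose[OF measurable_S]) simp
  show ?thesis by measurable
qed

lemma measurable_coeff_term [measurable]: "coeff_term n Q \<in> borel_measurable borel"
  unfolding coeff_term_def by (intro measurable_funpow_circ_op measurable_coeff_term_0)

lemma coeff_term_Suc: "coeff_term (Suc n) Q w = circ_op (coeff_term n Q) w"
  by (simp add: coeff_term_def)

lemma cmod_coeff_term_pow: "cmod (coeff_term n Q w) \<le> (exp (- 2) / 2) ^ n"
proof -
  have "cmod (coeff_term n Q w) \<le> (exp (- 2) / 2) ^ n * 1"
    unfolding coeff_term_def
    by (intro cmod_funpow_circ_op measurable_coeff_term_0) (simp add: cmod_centre_coeff)
  thus ?thesis by simp
qed

text \<open>Finite propagation: the initial assignment reaches at most \<rho> \<le> 1, and every
  application of \<open>circ_op\<close> moves by at most 2.\<close>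

lemma coeff_term_eq_0: "2 * real n + 1 < cmod (\<zeta> Q - w) \<Longrightarrow> coeff_term n Q w = 0"
proof (induction n arbitrary: w)
  case 0
  have "S w \<noteq> Q"
    using 0 S_near[of w] \<rho>_le_half by (auto simp: norm_minus_commute)
  thus ?case by (simp add: coeff_term_def)
next
  case (Suc n)
  have "coeff_term n Q (circ_point w t) = 0" for t
  proof (rule Suc.IH)
    have "cmod (\<zeta> Q - w) \<le> cmod (\<zeta> Q - circ_point w t) + cmod (circ_point w t - w)"
      by (metis norm_triangle_ineq diff_add_cancel add_diff_eq)
    thus "2 * real n + 1 < cmod (\<zeta> Q - circ_point w t)"
      using Suc.prems dist_circ_point[of w t] by simp
  qed
  thus ?case by (simp add: coeff_term_Suc circ_op_def)
qed

text \<open>A nonzero term has |\<zeta> Q - w| \<le> 2 n + 1, so exp (- 2 n) \<le> exp (1 - |\<zeta>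
  Q - w|). Half of the contraction thus becomes spatial decay, and (1 / 2)^n remains for the sum
  over rounds.\<close>

lemma cmod_coeff_term: "cmod (coeff_term n Q w) \<le> (1 / 2) ^ n * exp (1 - cmod (\<zeta> Q - w))"
proof (cases "2 * real n + 1 < cmod (\<zeta> Q - w)")
  case False
  have "cmod (coeff_term n Q w) \<le> (1 / 2) ^ n * exp (- 2) ^ n"
    using cmod_coeff_term_pow[of n Q w] by (simp add: power_divide)
  also have "exp (- 2) ^ n = exp (- 2 * real n)"
    by (subst exp_of_nat2_mult) simp
  also have "(1 / 2) ^ n * exp (- 2 * real n) \<le> (1 / 2) ^ n * exp (1 - cmod (\<zeta> Q - w))"
    using False by (intro mult_left_mono) auto
  finally show ?thesis .
qed (simp add: coeff_term_eq_0)

text \<open>Apply \<open>circ_op\<close> n times to \<open>fock_kernel_step\<close>.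
  \<open>F\<close> may be any large enough finite set, so one \<open>F\<close> serves all points of
  the circle in the induction.\<close>

lemma funpow_circ_op_diff:
  assumes "finite F" "F \<subseteq> P" "{Q\<in>P. cmod (\<zeta> Q - w) \<le> 2 * real n + 1} \<subseteq> F"
  shows "(circ_op ^^ n) (\<lambda>v. fock_kernel \<alpha> v z) w - (circ_op ^^ Suc n) (\<lambda>v. fock_kernel \<alpha> v z) w
    = (\<Sum>Q\<in>F. coeff_term n Q w * fock_kernel \<alpha> (\<zeta> Q) z)"
  using assms(3)
proof (induction n arbitrary: w)
  case 0
  have "cmod (\<zeta> (S w) - w) \<le> 1"
    using S_near[of w] \<rho>_le_half by (simp add: norm_minus_commute)
  hence "S w \<in> F" using 0 by auto
  have "(\<Sum>Q\<in>F. coeff_term 0 Q w * fock_kernel \<alpha> (\<zeta> Q) z)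
      = (\<Sum>Q\<in>F. if S w = Q then centre_coeff w * fock_kernel \<alpha> (\<zeta> Q) z else 0)"
    by (intro sum.cong) (auto simp: coeff_term_def)
  also have "\<dots> = centre_coeff w * fock_kernel \<alpha> (centre w) z"
    unfolding centre_def using \<open>S w \<in> F\<close> assms(1) by simp
  finally show ?case
    using fock_kernel_step[of w z] by (simp add: centre_def)
next
  case (Suc n)
  let ?k = "\<lambda>v. fock_kernel \<alpha> v z"
  \<comment> \<open>For fixed \<open>z\<close> the kernel is bounded in its parameter, which
    provides integrability over the circle.\<close>
  have k: "?k \<in> borel_measurable borel" "cmod (?k v) \<le> exp (\<alpha> / 2 * (cmod z)\<^sup>2)" for v
    using \<alpha>_pos by (auto simp: cmod_fock_kernel)
  have IH: "(circ_op ^^ n) ?k v - (circ_op ^^ Suc n) ?k v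
      = (\<Sum>Q\<in>F. coeff_term n Q v * fock_kernel \<alpha> (\<zeta> Q) z)" if "v = circ_point w t" for v t
  proof (rule Suc.IH)
    \<comment> \<open>\<open>v\<close> is within 2 of \<open>w\<close>, so the radius grows by 2,
      exactly the increment from \<open>n\<close> to \<open>Suc n\<close>.\<close>
    show "{Q \<in> P. cmod (\<zeta> Q - v) \<le> 2 * real n + 1} \<subseteq> F"
    proof safe
      fix Q assume Q: "Q \<in> P" "cmod (\<zeta> Q - v) \<le> 2 * real n + 1"
      have "cmod (\<zeta> Q - w) \<le> cmod (\<zeta> Q - v) + cmod (v - w)"
        using norm_triangle_ineq[of "\<zeta> Q - v" "v - w"] by simp
      also have "\<dots> \<le> 2 * real (Suc n) + 1"
        using Q(2) dist_circ_point[of w t] that by simp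
      finally show "Q \<in> F" using Suc.prems Q(1) by blast
    qed
  qed
  have int: "integrable circ (\<lambda>t. circ_coeff w t * (circ_op ^^ m) ?k (circ_point w t))" for m
    by (rule integrable_circ_op[OF _ cmod_funpow_circ_op]) (use k in auto)
  have "(circ_op ^^ Suc n) ?k w - (circ_op ^^ Suc (Suc n)) ?k w
      = (LINT t|circ. circ_coeff w t * (circ_op ^^ n) ?k (circ_point w t)
          - circ_coeff w t * (circ_op ^^ Suc n) ?k (circ_point w t))"
    unfolding Bochner_Integration.integral_diff[OF int int] by (simp add: circ_op_def[of _ w])
  also have "\<dots> = (LINT t|circ. (\<Sum>Q\<in>F. fock_kernel \<alpha> (\<zeta> Q) z *
      (circ_coeff w t * coeff_term n Q (circ_point w t))))"
    by (simp only: right_diff_distrib[symmetric] IH[OF refl] sum_distrib_left mult_ac)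
  also have "\<dots> = (\<Sum>Q\<in>F. LINT t|circ. fock_kernel \<alpha> (\<zeta> Q) z *
      (circ_coeff w t * coeff_term n Q (circ_point w t)))"
    by (intro Bochner_Integration.integral_sum integrable_mult_right integrable_circ_op)
       (auto intro: cmod_coeff_term_pow)
  also have "\<dots> = (\<Sum>Q\<in>F. coeff_term (Suc n) Q w * fock_kernel \<alpha> (\<zeta> Q) z)"
    by (simp add: coeff_term_Suc circ_op_def mult.commute)
  finally show ?case .
qed

section \<open>Summation over all rounds\<close>

definition coeff :: "complex \<Rightarrow> 'i \<Rightarrow> complex" where
  "coeff w Q = (\<Sum>n. coeff_term n Q w)"

lemma summable_coeff_term: "summable (\<lambda>n. cmod (coeff_term n Q w))"
  by (rule summable_comparison_test[of _ "\<lambda>n. (1 / 2) ^ n * exp (1 - cmod (\<zeta> Q - w))"])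
     (auto simp: cmod_coeff_term intro!: summable_mult2 summable_geometric)

text \<open>The geometric series over the rounds contributes the factor 2; the constant is
  absolute.\<close>

lemma cmod_coeff: "cmod (coeff w Q) \<le> 2 * exp 1 * exp (- cmod (\<zeta> Q - w))"
proof -
  have "(\<lambda>n. (1 / 2) ^ n * exp (1 - cmod (\<zeta> Q - w))) sums (1 / (1 - 1 / 2) * exp (1 - cmod (\<zeta> Q - w)))"
    by (intro sums_mult2 geometric_sums) simp
  hence "cmod (coeff w Q) \<le> 1 / (1 - 1 / 2) * exp (1 - cmod (\<zeta> Q - w))"
    unfolding coeff_def
    by (metis (no_types, lifting) norm_suminf_le cmod_coeff_term sums_summable sums_unique)
  also have "\<dots> = 2 * exp 1 * exp (- cmod (\<zeta> Q - w))"
    by (simp add: exp_diff exp_minus field_simps)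
  finally show ?thesis .
qed

text \<open>Sum the double family over rounds and centres in both orders. Centres first gives
  differences of consecutive remainders, which telescope to the kernel; rounds first gives
  \<open>coeff\<close>.\<close>

lemma fock_kernel_has_sum:
  assumes summ: "(\<lambda>Q. exp (- cmod (\<zeta> Q - w))) summable_on P"
  shows "((\<lambda>Q. coeff w Q * fock_kernel \<alpha> (\<zeta> Q) z) has_sum fock_kernel \<alpha> w z) P"
proof -
  let ?k = "\<lambda>v. fock_kernel \<alpha> v z"
  define K where "K = exp (\<alpha> / 2 * (cmod z)\<^sup>2)"
  have k: "?k \<in> borel_measurable borel" "cmod (?k v) \<le> K" for v
    using \<alpha>_pos by (auto simp: cmod_fock_kernel K_def)
  have "0 \<le> K" by (simp add: K_def)
  define R where "R n = (circ_op ^^ n) ?k w" for n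
  define f where "f = (\<lambda>(n, Q). coeff_term n Q w * ?k (\<zeta> Q))"
  have R: "cmod (R n) \<le> K * (1 / 2) ^ n" for n
  proof -
    have "cmod (R n) \<le> (exp (- 2) / 2) ^ n * K"
      unfolding R_def by (rule cmod_funpow_circ_op) (use k in auto)
    also have "\<dots> \<le> (1 / 2) ^ n * K"
      using \<open>0 \<le> K\<close> by (intro mult_right_mono power_mono) auto
    finally show ?thesis by (simp add: mult.commute)
  qed
  have sumK: "summable (\<lambda>n. K * (1 / 2) ^ n)"
    by (intro summable_mult summable_geometric) simp
  have "R \<longlonglongrightarrow> 0"
    by (rule Lim_null_comparison[OF always_eventually summable_LIMSEQ_zero[OF sumK]]) (use R in auto)
  hence "(\<lambda>n. R n - R (Suc n)) sums R 0"
    using telescope_sums'[of R 0] by simp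
  \<comment> \<open>\<open>has_sum\<close> is unordered, so the telescoping series must also
    converge absolutely.\<close>
  moreover have "summable (\<lambda>n. cmod (R n - R (Suc n)))"
  proof (rule summable_comparison_test'[OF summable_add[OF sumK iffD2[OF summable_Suc_iff sumK]]])
    show "norm (cmod (R n - R (Suc n))) \<le> K * (1 / 2) ^ n + K * (1 / 2) ^ Suc n" for n
      using norm_triangle_ineq4[of "R n" "R (Suc n)"] R[of n] R[of "Suc n"] by simp
  qed
  ultimately have outer: "((\<lambda>n. R n - R (Suc n)) has_sum ?k w) UNIV"
    using norm_summable_imp_has_sum[of "\<lambda>n. R n - R (Suc n)"] by (simp add: R_def)
  have inner: "((\<lambda>Q. f (n, Q)) has_sum (R n - R (Suc n))) P" for n
  proof (rule has_sum_finite_neutralI)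
    show "finite {Q\<in>P. cmod (\<zeta> Q - w) \<le> 2 * real n + 1}" by (rule finite_near)
    show "R n - R (Suc n) = (\<Sum>Q | Q \<in> P \<and> cmod (\<zeta> Q - w) \<le> 2 * real n + 1. f (n, Q))"
      unfolding R_def f_def prod.case
      by (rule funpow_circ_op_diff) (auto simp: finite_near)
  qed (auto simp: f_def coeff_term_eq_0)
  define C where "C = infsum (\<lambda>Q. exp (- cmod (\<zeta> Q - w))) P"
  \<comment> \<open>A product majorant, geometric in the round and exponential in the distance,
    justifies exchanging the two sums.\<close>
  have "(\<lambda>(n, Q). ((1 / 2) ^ n * exp 1 * K) * exp (- cmod (\<zeta> Q - w))) summable_on UNIV \<times> P"
  proof (rule summable_on_SigmaI)
    show "((\<lambda>Q. case (n, Q) of (n, Q) \<Rightarrow> ((1 / 2) ^ n * exp 1 * K) * exp (- cmod (\<zeta> Q - w)))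
        has_sum ((1 / 2) ^ n * exp 1 * K) * C) P" for n
      unfolding prod.case C_def by (intro has_sum_cmult_right has_sum_infsum summ)
    have "summable (\<lambda>n. (1 / 2) ^ n * (exp 1 * K * C))"
      by (intro summable_mult2 summable_geometric) simp
    moreover have "0 \<le> C" unfolding C_def by (intro infsum_nonneg) simp
    ultimately show "(\<lambda>n. (1 / 2) ^ n * exp 1 * K * C) summable_on (UNIV :: nat set)"
      using \<open>0 \<le> K\<close> by (intro norm_summable_imp_summable_on) (simp add: mult.assoc)
  qed (use \<open>0 \<le> K\<close> in auto)
  hence "(\<lambda>x. norm (f x)) summable_on UNIV \<times> P"
  proof (rule summable_on_comparison_test)
    fix x :: "nat \<times> 'i"
    obtain n Q where x: "x = (n, Q)" by (cases x)
    have "exp (1 - cmod (\<zeta> Q - w)) = exp 1 * exp (- cmod (\<zeta> Q - w))"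
      by (simp flip: exp_add)
    moreover have "norm (f x) \<le> ((1 / 2) ^ n * exp (1 - cmod (\<zeta> Q - w))) * K"
      unfolding x f_def prod.case norm_mult
      by (intro mult_mono cmod_coeff_term k) auto
    ultimately show "norm (f x) \<le> (case x of (n, Q) \<Rightarrow> ((1 / 2) ^ n * exp 1 * K) * exp (- cmod (\<zeta> Q - w)))"
      by (simp only: x prod.case mult_ac)
  qed auto
  hence "f summable_on UNIV \<times> P"
    by (rule abs_summable_summable)
  hence "(f has_sum ?k w) (UNIV \<times> P)"
    by (intro has_sum_SigmaI[OF inner outer])
  hence "((\<lambda>(Q, n). f (n, Q)) has_sum ?k w) (P \<times> UNIV)"
    by (rule has_sum_swap[THEN iffD1])
  thus ?thesis
  proof (rule has_sum_Sigma')
    fix Q assume "Q \<in> P"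
    have "((\<lambda>n. coeff_term n Q w) has_sum coeff w Q) UNIV"
      unfolding coeff_def
      by (intro norm_summable_imp_has_sum summable_coeff_term summable_sums summable_norm_cancel[OF summable_coeff_term])
    thus "((\<lambda>n. case (Q, n) of (Q, n) \<Rightarrow> f (n, Q)) has_sum coeff w Q * ?k (\<zeta> Q)) UNIV"
      unfolding f_def prod.case by (rule has_sum_cmult_left)
  qed
qed

end

section \<open>Pocket decompositions\<close>

lemma summable_on_exp_minus_abs_int:
  fixes a :: real
  assumes "a > 0"
  shows "(\<lambda>m::int. exp (- a * \<bar>of_int m\<bar>)) summable_on UNIV"
proof -
  have "summable (\<lambda>n. exp (- a) ^ n)"
    using assms by (intro summable_geometric) simp
  moreover have "norm (exp (- a * real n)) = exp (- a) ^ n" for n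
    unfolding exp_of_nat2_mult by simp
  ultimately have *: "(\<lambda>n::nat. exp (- a * real n)) summable_on UNIV"
    by (intro norm_summable_imp_summable_on) simp
  have "(\<lambda>m::int. exp (- a * \<bar>of_int m\<bar>)) summable_on range int"
    by (subst summable_on_reindex) (use * in \<open>simp_all add: o_def\<close>)
  moreover have "(\<lambda>m::int. exp (- a * \<bar>of_int m\<bar>)) summable_on range (\<lambda>n. - int n)"
    by (subst summable_on_reindex) (use * in \<open>simp_all add: o_def inj_on_def\<close>)
  ultimately have "(\<lambda>m::int. exp (- a * \<bar>of_int m\<bar>)) summable_on (range int \<union> range (\<lambda>n. - int n))"
    by (rule summable_on_union)
  moreover have "range int \<union> range (\<lambda>n. - int n) = UNIV"
  proof (rule UNIV_eq_I[symmetric])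
    show "m \<in> range int \<union> range (\<lambda>n. - int n)" for m
      by (cases m rule: int_cases2) auto
  qed
  ultimately show ?thesis by simp
qed

lemma summable_on_exp_minus_abs_int_prod:
  fixes a :: real
  assumes "a > 0"
  shows "(\<lambda>(m, n). exp (- a * (\<bar>of_int m\<bar> + \<bar>of_int n\<bar>))) summable_on (UNIV :: (int \<times> int) set)"
proof -
  obtain s where s: "((\<lambda>m::int. exp (- a * \<bar>of_int m\<bar>)) has_sum s) UNIV"
    using summable_on_exp_minus_abs_int[OF assms] by (auto simp: summable_on_def)
  have "(\<lambda>(m, n). exp (- a * (\<bar>of_int m\<bar> + \<bar>of_int n\<bar>))) summable_on (UNIV :: int set) \<times> (UNIV :: int set)"
  proof (rule summable_on_SigmaI)
    show "((\<lambda>n. case (m, n) of (m, n) \<Rightarrow> exp (- a * (\<bar>of_int m\<bar> + \<bar>of_int n\<bar>))) has_sum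
        exp (- a * \<bar>of_int m\<bar>) * s) UNIV" for m :: int
      unfolding prod.case distrib_left exp_add by (rule has_sum_cmult_right[OF s])
    show "(\<lambda>m::int. exp (- a * \<bar>of_int m\<bar>) * s) summable_on UNIV"
      by (rule summable_on_cmult_left[OF summable_on_exp_minus_abs_int[OF assms]])
  qed auto
  thus ?thesis by simp
qed

lemma lattice_dist_ge: "(\<bar>of_int m\<bar> + \<bar>of_int n\<bar>) / 2 \<le> lattice_dist (m, n) (0, 0)"
proof -
  have "\<bar>real_of_int m\<bar> \<le> lattice_dist (m, n) (0, 0)" "\<bar>real_of_int n\<bar> \<le> lattice_dist (m, n) (0, 0)"
    unfolding lattice_dist_def by (auto intro!: real_le_rsqrt)
  thus ?thesis by simp
qed

text \<open>Compare each cell with the one of index (0, 0) by the lower Lipschitz bound;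
  \<open>D\<close> absorbs the distance from that centre to \<open>w\<close>. The dependence of
  \<open>D\<close> on \<open>w\<close> is harmless, as it enters only summability and
  finiteness.\<close>

lemma bilipschitz_growth:
  assumes "bilipschitz_pocket_decomposition \<delta> c_in C_out C_L P \<zeta>" "0 < \<delta>" "C_L \<ge> 1"
  obtains \<Phi> :: "complex set \<Rightarrow> int \<times> int" and \<kappa> D :: real
  where "bij_betw \<Phi> P UNIV" "\<kappa> > 0"
    "\<And>Q m n. Q \<in> P \<Longrightarrow> \<Phi> Q = (m, n) \<Longrightarrow> \<kappa> * (\<bar>of_int m\<bar> + \<bar>of_int n\<bar>) - D \<le> cmod (\<zeta> Q - w)"
proof -
  obtain \<Phi> :: "complex set \<Rightarrow> int \<times> int" where \<Phi>: "bij_betw \<Phi> P UNIV"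
    and lip: "\<And>Q Q'. Q \<in> P \<Longrightarrow> Q' \<in> P \<Longrightarrow>
        inverse C_L * \<delta> * lattice_dist (\<Phi> Q) (\<Phi> Q') \<le> cmod (\<zeta> Q - \<zeta> Q')"
    using assms(1) unfolding bilipschitz_pocket_decomposition_def by blast
  obtain Q0 where Q0: "Q0 \<in> P" "\<Phi> Q0 = (0, 0)"
    using \<Phi> by (metis UNIV_I bij_betw_iff_bijections)
  show ?thesis
  proof (rule that[OF \<Phi>])
    show pos: "inverse C_L * \<delta> / 2 > 0" using assms by simp
    fix Q m n assume Q: "Q \<in> P" "\<Phi> Q = (m, n)"
    have "inverse C_L * \<delta> / 2 * (\<bar>of_int m\<bar> + \<bar>of_int n\<bar>)
        = inverse C_L * \<delta> * ((\<bar>of_int m\<bar> + \<bar>of_int n\<bar>) / 2)"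
      by simp
    also have "\<dots> \<le> inverse C_L * \<delta> * lattice_dist (\<Phi> Q) (\<Phi> Q0)"
      unfolding Q Q0 using pos by (intro mult_left_mono lattice_dist_ge) simp
    also have "\<dots> \<le> cmod (\<zeta> Q - \<zeta> Q0)"
      by (rule lip[OF Q(1) Q0(1)])
    also have "\<dots> \<le> cmod (\<zeta> Q - w) + cmod (\<zeta> Q0 - w)"
      using norm_triangle_ineq4[of "\<zeta> Q - w" "\<zeta> Q0 - w"] by simp
    finally show "inverse C_L * \<delta> / 2 * (\<bar>of_int m\<bar> + \<bar>of_int n\<bar>) - cmod (\<zeta> Q0 - w) \<le> cmod (\<zeta> Q - w)"
      by simp
  qed
qed

lemma bilipschitz_summable:
  fixes a :: real
  assumes "bilipschitz_pocket_decomposition \<delta> c_in C_out C_L P \<zeta>" "0 < \<delta>" "C_L \<ge> 1" "a > 0"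
  shows "(\<lambda>Q. exp (- a * cmod (\<zeta> Q - w))) summable_on P"
proof -
  from bilipschitz_growth[OF assms(1-3), of w]
  obtain \<Phi> :: "complex set \<Rightarrow> int \<times> int" and \<kappa> D :: real where \<Phi>: "bij_betw \<Phi> P UNIV" "\<kappa> > 0"
    "\<And>Q m n. Q \<in> P \<Longrightarrow> \<Phi> Q = (m, n) \<Longrightarrow> \<kappa> * (\<bar>of_int m\<bar> + \<bar>of_int n\<bar>) - D \<le> cmod (\<zeta> Q - w)" by metis
  define f where "f = (\<lambda>(m::int, n::int). exp (- (a * \<kappa>) * (\<bar>of_int m\<bar> + \<bar>of_int n\<bar>)))"
  have "f summable_on UNIV"
    unfolding f_def using assms \<Phi>(2) by (intro summable_on_exp_minus_abs_int_prod) simp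
  hence "(\<lambda>Q. f (\<Phi> Q)) summable_on P"
    by (simp add: summable_on_reindex_bij_betw[OF \<Phi>(1)])
  hence "(\<lambda>Q. exp (a * D) * f (\<Phi> Q)) summable_on P"
    by (rule summable_on_cmult_right)
  thus ?thesis
  proof (rule summable_on_comparison_test)
    fix Q assume Q: "Q \<in> P"
    obtain m n where mn: "\<Phi> Q = (m, n)" by (cases "\<Phi> Q")
    have "a * (\<kappa> * (\<bar>of_int m\<bar> + \<bar>of_int n\<bar>) - D) \<le> a * cmod (\<zeta> Q - w)"
      using \<Phi>(3)[OF Q mn] assms by (intro mult_left_mono) auto
    thus "exp (- a * cmod (\<zeta> Q - w)) \<le> exp (a * D) * f (\<Phi> Q)"
      by (simp add: f_def mn algebra_simps flip: exp_add)
  qed simp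
qed

text \<open>By linear growth, the indices of the centres in question lie in a finite square of the
  lattice.\<close>

lemma bilipschitz_locally_finite:
  assumes "bilipschitz_pocket_decomposition \<delta> c_in C_out C_L P \<zeta>" "0 < \<delta>" "C_L \<ge> 1"
  shows "finite {Q\<in>P. cmod (\<zeta> Q - w) \<le> R}"
proof -
  from bilipschitz_growth[OF assms, of w]
  obtain \<Phi> :: "complex set \<Rightarrow> int \<times> int" and \<kappa> D :: real where \<Phi>: "bij_betw \<Phi> P UNIV" "\<kappa> > 0"
    "\<And>Q m n. Q \<in> P \<Longrightarrow> \<Phi> Q = (m, n) \<Longrightarrow> \<kappa> * (\<bar>of_int m\<bar> + \<bar>of_int n\<bar>) - D \<le> cmod (\<zeta> Q - w)" by metis
  define L where "L = \<lceil>(R + D) / \<kappa>\<rceil>"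
  show ?thesis
  proof (rule finite_imageD)
    show "inj_on \<Phi> {Q\<in>P. cmod (\<zeta> Q - w) \<le> R}"
      using \<Phi>(1) by (auto simp: bij_betw_def inj_on_def)
    have "\<Phi> Q \<in> {- L..L} \<times> {- L..L}" if Q: "Q \<in> P" "cmod (\<zeta> Q - w) \<le> R" for Q
    proof -
      obtain m n where mn: "\<Phi> Q = (m, n)" by (cases "\<Phi> Q")
      have "(\<bar>of_int m\<bar> + \<bar>of_int n\<bar>) * \<kappa> \<le> R + D"
        using \<Phi>(3)[OF Q(1) mn] Q(2) by (simp add: mult.commute)
      hence "\<bar>of_int m\<bar> + \<bar>of_int n\<bar> \<le> (R + D) / \<kappa>"
        using \<Phi>(2) by (simp add: pos_le_divide_eq)
      hence "of_int (\<bar>m\<bar> + \<bar>n\<bar>) \<le> (R + D) / \<kappa>" by simp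
      hence "\<bar>m\<bar> + \<bar>n\<bar> \<le> L"
        unfolding L_def using le_of_int_ceiling[of "(R + D) / \<kappa>"] by linarith
      thus ?thesis by (auto simp: mn)
    qed
    thus "finite (\<Phi> ` {Q\<in>P. cmod (\<zeta> Q - w) \<le> R})"
      by (intro finite_subset[OF _ finite_cartesian_product[of "{- L..L}" "{- L..L}"]] image_subsetI) auto
  qed
qed

text \<open>\<open>w\<close> itself may lie in the uncovered null set, but a ball around it is not
  null and so meets some pocket at a point \<open>u\<close>. Both \<open>w\<close> and the centre
  are within \<open>C_out * \<delta>\<close> of \<open>u\<close>, hence the factor 2.\<close>

lemma pocket_centre_near:
  assumes "pocket_decomposition \<delta> c_in C_out P \<zeta>" "0 < C_out * \<delta>"
  obtains Q where "Q \<in> P" "cmod (w - \<zeta> Q) \<le> 2 * C_out * \<delta>"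
proof -
  have "\<not> ball w (C_out * \<delta>) \<subseteq> UNIV - \<Union>P"
  proof
    assume "ball w (C_out * \<delta>) \<subseteq> UNIV - \<Union>P"
    moreover have "UNIV - \<Union>P \<in> null_sets lborel"
      using assms(1) by (simp add: pocket_decomposition_def)
    ultimately have "ball w (C_out * \<delta>) \<in> null_sets lborel"
      using null_sets_subset by (metis borel_open open_ball sets_lborel)
    hence "negligible (ball w (C_out * \<delta>))"
      by (simp add: negligible_iff_null_sets null_sets_completionI)
    thus False
      using assms(2) open_not_negligible[of "ball w (C_out * \<delta>)"] by simp
  qed
  then obtain u Q where u: "u \<in> ball w (C_out * \<delta>)" "u \<in> Q" "Q \<in> P" by auto
  moreover have "u \<in> ball (\<zeta> Q) (C_out * \<delta>)"
    using assms(1) u unfolding pocket_decomposition_def by blast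
  ultimately have "dist w (\<zeta> Q) \<le> 2 * C_out * \<delta>"
    using dist_triangle[of w "\<zeta> Q" u] by (simp add: dist_commute)
  thus ?thesis using that u(3) by (simp add: dist_norm)
qed

text \<open>Enumerate the countable family and take the least admissible index, a measurable
  function of \<open>w\<close>.\<close>

lemma measurable_choice:
  assumes "countable P" and near: "\<And>w::complex. \<exists>Q\<in>P. cmod (w - \<zeta> Q) \<le> \<rho>"
  obtains S where "S \<in> borel \<rightarrow>\<^sub>M count_space P" "\<And>w. cmod (w - \<zeta> (S w)) \<le> \<rho>"
proof -
  define N where "N w = (LEAST n. cmod (w - \<zeta> (from_nat_into P n)) \<le> \<rho>)" for w
  have ne: "P \<noteq> {}" using near by auto
  show ?thesis
  proof (rule that[of "\<lambda>w. from_nat_into P (N w)"])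
    have "N \<in> borel \<rightarrow>\<^sub>M count_space UNIV"
      unfolding N_def[abs_def] by measurable
    moreover have "from_nat_into P \<in> count_space UNIV \<rightarrow>\<^sub>M count_space P"
      using from_nat_into[OF ne] by simp
    ultimately show "(\<lambda>w. from_nat_into P (N w)) \<in> borel \<rightarrow>\<^sub>M count_space P"
      by (rule measurable_compose)
    fix w
    obtain Q where "Q \<in> P" "cmod (w - \<zeta> Q) \<le> \<rho>" using near by blast
    then obtain n where "cmod (w - \<zeta> (from_nat_into P n)) \<le> \<rho>"
      using assms(1) by (metis from_nat_into_surj)
    thus "cmod (w - \<zeta> (from_nat_into P (N w))) \<le> \<rho>"
      unfolding N_def by (rule LeastI)
  qed
qed

text \<open>The curves \<gamma> t^\<beta> and t cross at
  \<open>\<gamma> powr (1 / (1 - \<beta>))\<close>. Beyond it the linear term dominates; before it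
  monotonicity bounds the power by its value there.\<close>

lemma powr_le_linear:
  fixes \<gamma> \<beta> t :: real
  assumes "0 < \<beta>" "\<beta> < 1" "\<gamma> > 0" "0 \<le> t"
  shows "\<gamma> * t powr \<beta> \<le> t + \<gamma> * (\<gamma> powr (1 / (1 - \<beta>))) powr \<beta>"
proof (cases "t \<le> \<gamma> powr (1 / (1 - \<beta>))")
  case True
  hence "\<gamma> * t powr \<beta> \<le> \<gamma> * (\<gamma> powr (1 / (1 - \<beta>))) powr \<beta>"
    using assms by (intro mult_left_mono powr_mono2) auto
  thus ?thesis using assms by linarith
next
  case False
  have "\<gamma> = (\<gamma> powr (1 / (1 - \<beta>))) powr (1 - \<beta>)"
    using assms by (simp add: powr_powr)
  also have "\<dots> \<le> t powr (1 - \<beta>)"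
    using False assms by (intro powr_mono2) auto
  finally have "\<gamma> * t powr \<beta> \<le> t powr (1 - \<beta>) * t powr \<beta>"
    by (rule mult_right_mono) simp
  also have "\<dots> = t"
    using assms by (simp flip: powr_add)
  moreover have "0 \<le> \<gamma> * (\<gamma> powr (1 / (1 - \<beta>))) powr \<beta>"
    using assms by simp
  ultimately show ?thesis by linarith
qed

text \<open>Instantiates \<open>kernel_net\<close> with radius \<open>2 * C_out * \<delta>\<close>.
  One family of coefficients serves every \<eta>, with a bound uniform in the decomposition.\<close>

lemma pocket_expansion:
  assumes \<alpha>: "\<alpha> > 0" and C_out: "C_out > 0" and C_L: "C_L \<ge> 1" and \<delta>: "0 < \<delta>"
    and small: "4 * exp (\<alpha> / 2 + 2) * (2 * C_out * \<delta>) \<le> 1"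
    and P: "bilipschitz_pocket_decomposition \<delta> c_in C_out C_L P \<zeta>"
  shows "\<exists>b :: complex \<Rightarrow> complex set \<Rightarrow> complex. \<forall>\<eta>.
    fock_has_sum \<alpha> (\<lambda>Q z. b \<eta> Q * fock_kernel \<alpha> (\<zeta> Q) z) (fock_kernel \<alpha> \<eta>) P \<and>
    (\<forall>Q. cmod (b \<eta> Q) \<le> 2 * exp 1 * exp (- cmod (\<zeta> Q - \<eta>)))"
proof -
  have pd: "pocket_decomposition \<delta> c_in C_out P \<zeta>"
    using P by (simp add: bilipschitz_pocket_decomposition_def)
  have "countable P"
    using pd by (simp add: pocket_decomposition_def)
  moreover have "\<exists>Q\<in>P. cmod (w - \<zeta> Q) \<le> 2 * C_out * \<delta>" for w
    using pocket_centre_near[OF pd] C_out \<delta> by (metis mult_pos_pos)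
  ultimately obtain S where S: "S \<in> borel \<rightarrow>\<^sub>M count_space P" "\<And>w. cmod (w - \<zeta> (S w)) \<le> 2 * C_out * \<delta>"
    using measurable_choice by metis
  interpret kernel_net \<alpha> "2 * C_out * \<delta>" P \<zeta> S
    by unfold_locales (fact \<alpha> small S bilipschitz_locally_finite[OF P \<delta> C_L])+
  have "fock_has_sum \<alpha> (\<lambda>Q z. coeff \<eta> Q * fock_kernel \<alpha> (\<zeta> Q) z) (fock_kernel \<alpha> \<eta>) P" for \<eta>
  proof (rule fock_has_sum_kernels[OF \<alpha> _ cmod_coeff])
    show "((\<lambda>Q. coeff \<eta> Q * fock_kernel \<alpha> (\<zeta> Q) z) has_sum fock_kernel \<alpha> \<eta> z) P" for z
      using bilipschitz_summable[OF P \<delta> C_L, of 1 \<eta>] by (intro fock_kernel_has_sum) simp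
    show "(\<lambda>Q. exp (- cmod (\<zeta> Q - \<eta>) / 2)) summable_on P"
      using bilipschitz_summable[OF P \<delta> C_L, of "1 / 2" \<eta>] by simp
  qed
  thus ?thesis
    using cmod_coeff by blast
qed

theorem theorem4p3:
  fixes \<alpha> c_in C_out C_L :: real
  assumes "\<alpha> > 0" and "0 < c_in" and "c_in < C_out" and "C_L \<ge> 1"
  shows "\<exists>\<delta>\<^sub>0>0. \<forall>\<delta>::real. 0 < \<delta> \<and> \<delta> < \<delta>\<^sub>0 \<longrightarrow>
    (\<forall>P \<zeta>. bilipschitz_pocket_decomposition \<delta> c_in C_out C_L P \<zeta> \<longrightarrow>
       (\<forall>\<eta>. \<exists>b :: complex set \<Rightarrow> complex.
          fock_has_sum \<alpha> (\<lambda>Q z. b Q * fock_kernel \<alpha> (\<zeta> Q) z) (fock_kernel \<alpha> \<eta>) P)) \<and>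
    (\<forall>\<beta> \<gamma> :: real. 0 < \<beta> \<and> \<beta> < 1 \<and> \<gamma> > 0 \<longrightarrow>
       (\<exists>C_env :: real. \<forall>P \<zeta>. bilipschitz_pocket_decomposition \<delta> c_in C_out C_L P \<zeta> \<longrightarrow>
          (\<exists>b :: complex \<Rightarrow> complex set \<Rightarrow> complex. \<forall>\<eta>.
             fock_has_sum \<alpha> (\<lambda>Q z. b \<eta> Q * fock_kernel \<alpha> (\<zeta> Q) z) (fock_kernel \<alpha> \<eta>) P \<and>
             (\<forall>Q\<in>P. cmod (b \<eta> Q) \<le> C_env * exp (- \<gamma> * cmod (\<zeta> Q - \<eta>) powr \<beta>)))))"
proof -
  \<comment> \<open>At this value 4 exp (\<alpha> / 2 + 2) times the radius
    \<open>2 * C_out * \<delta>\<close> equals 1.\<close>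
  define \<delta>\<^sub>0 where "\<delta>\<^sub>0 = 1 / (8 * exp (\<alpha> / 2 + 2) * C_out)"
  have C_out: "C_out > 0" using assms by simp
  have expansion: "\<exists>b :: complex \<Rightarrow> complex set \<Rightarrow> complex. \<forall>\<eta>.
      fock_has_sum \<alpha> (\<lambda>Q z. b \<eta> Q * fock_kernel \<alpha> (\<zeta> Q) z) (fock_kernel \<alpha> \<eta>) P \<and>
      (\<forall>Q. cmod (b \<eta> Q) \<le> 2 * exp 1 * exp (- cmod (\<zeta> Q - \<eta>)))"
    if \<delta>: "0 < \<delta>" "\<delta> < \<delta>\<^sub>0" and P: "bilipschitz_pocket_decomposition \<delta> c_in C_out C_L P \<zeta>" for \<delta> P \<zeta>
  proof (rule pocket_expansion[OF assms(1) C_out assms(4) \<delta>(1) _ P])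
    have "\<delta> * (8 * exp (\<alpha> / 2 + 2) * C_out) < 1"
      using \<delta>(2) C_out by (simp add: \<delta>\<^sub>0_def pos_less_divide_eq)
    thus "4 * exp (\<alpha> / 2 + 2) * (2 * C_out * \<delta>) \<le> 1" by (simp add: mult_ac)
  qed
  show ?thesis
  proof (rule exI[of _ \<delta>\<^sub>0], intro conjI allI impI)
    show "\<delta>\<^sub>0 > 0" using C_out by (simp add: \<delta>\<^sub>0_def)
    show "\<exists>b. fock_has_sum \<alpha> (\<lambda>Q z. b Q * fock_kernel \<alpha> (\<zeta> Q) z) (fock_kernel \<alpha> \<eta>) P"
      if "0 < \<delta> \<and> \<delta> < \<delta>\<^sub>0" "bilipschitz_pocket_decomposition \<delta> c_in C_out C_L P \<zeta>" for \<delta> P \<zeta> \<eta>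
      using expansion[OF _ _ that(2)] that(1) by blast
    fix \<delta> \<beta> \<gamma> :: real
    assume \<delta>: "0 < \<delta> \<and> \<delta> < \<delta>\<^sub>0" and \<beta>\<gamma>: "0 < \<beta> \<and> \<beta> < 1 \<and> \<gamma> > 0"
    \<comment> \<open>\<open>M\<close> bounds \<gamma> t^\<beta> - t over t \<ge> 0, the cost of
      weakening exp (- t) to the stretched exponential.\<close>
    define M where "M = \<gamma> * (\<gamma> powr (1 / (1 - \<beta>))) powr \<beta>"
    have M: "2 * exp 1 * exp (- t) \<le> 2 * exp 1 * exp M * exp (- \<gamma> * t powr \<beta>)" if "0 \<le> t" for t
      using powr_le_linear[of \<beta> \<gamma> t] \<beta>\<gamma> that by (simp add: M_def mult.assoc flip: exp_add)
    show "\<exists>C_env. \<forall>P \<zeta>. bilipschitz_pocket_decomposition \<delta> c_in C_out C_L P \<zeta> \<longrightarrow>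
        (\<exists>b. \<forall>\<eta>. fock_has_sum \<alpha> (\<lambda>Q z. b \<eta> Q * fock_kernel \<alpha> (\<zeta> Q) z) (fock_kernel \<alpha> \<eta>) P \<and>
          (\<forall>Q\<in>P. cmod (b \<eta> Q) \<le> C_env * exp (- \<gamma> * cmod (\<zeta> Q - \<eta>) powr \<beta>)))"
    \<comment> \<open>This constant is fixed before the decomposition is given; it involves only
      \<beta> and \<gamma>.\<close>
    proof (rule exI[of _ "2 * exp 1 * exp M"], intro allI impI)
      fix P \<zeta>
      assume P: "bilipschitz_pocket_decomposition \<delta> c_in C_out C_L P \<zeta>"
      obtain b :: "complex \<Rightarrow> complex set \<Rightarrow> complex" where b: "\<And>\<eta>.
          fock_has_sum \<alpha> (\<lambda>Q z. b \<eta> Q * fock_kernel \<alpha> (\<zeta> Q) z) (fock_kernel \<alpha> \<eta>) P"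
        "\<And>\<eta> Q. cmod (b \<eta> Q) \<le> 2 * exp 1 * exp (- cmod (\<zeta> Q - \<eta>))"
        using expansion[OF conjunct1[OF \<delta>] conjunct2[OF \<delta>] P] by blast
      show "\<exists>b. \<forall>\<eta>. fock_has_sum \<alpha> (\<lambda>Q z. b \<eta> Q * fock_kernel \<alpha> (\<zeta> Q) z) (fock_kernel \<alpha> \<eta>) P \<and>
          (\<forall>Q\<in>P. cmod (b \<eta> Q) \<le> 2 * exp 1 * exp M * exp (- \<gamma> * cmod (\<zeta> Q - \<eta>) powr \<beta>))"
        by (intro exI[of _ b] allI conjI ballI b(1) order_trans[OF b(2) M]) simp
    qed
  qed
qed

end
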